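(* Let $(C,\partial)$ and $(C',\partial)$ be chain complexes, bounded from below. Let $\varphi,\psi:C\to C'$ be chain maps. Assume that there is an element $\epsilon\in C_0$ with $\partial\epsilon=0$ and a chain map $\delta:C'\to(\mathbb{Z},0)$ such that $$\delta(\varphi(\epsilon))=\delta(\psi(\epsilon))=1.$$ If $\varphi\otimes\psi$ is homotopic to $\psi\otimes\varphi$, then $\varphi$ is homotopic to $\psi$.
   Context: Chain complexes are complexes of Abelian groups, tensor products are over $\mathbb{Z}$, and "homotopic" means chain homotopic; $\varphi\otimes\psi$ and $\psi\otimes\varphi$ are chain maps $C\otimes C\to C'\otimes C'$. $(\mathbb{Z},0)$ denotes the chain complex which is $\mathbb{Z}$ in degree zero and vanishes in every other degree, with trivial boundary operator. *)

theory Defs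
  imports "HOL-Algebra.Free_Abelian_Groups"
begin

text \<open>
  Abelian groups are the \<^const>\<open>comm_group\<close>s of HOL-Algebra, written multiplicatively:
  the zero of a group is its \<open>\<one>\<close>, its sum is \<open>\<otimes>\<close> and the negative is \<open>inv\<close>.
  Chain complexes are graded by all of \<^typ>\<open>int\<close>; all the groups of a complex are carved out
  of one type, and a graded map \<open>f\<close> matters only on the carriers.
\<close>

section \<open>Chain complexes, chain maps, chain homotopy\<close>

record 'a chain_cx =
  grp :: "int \<Rightarrow> 'a monoid"
  bd :: "int \<Rightarrow> 'a \<Rightarrow> 'a"  \<comment> \<open>\<open>bd C n\<close> goes from degree \<open>n\<close> to degree \<open>n - 1\<close>\<close>

definition chain_complex :: "'a chain_cx \<Rightarrow> bool" where
  "chain_complex C \<longleftrightarrow>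
     (\<forall>n. comm_group (grp C n)) \<and>
     (\<forall>n. bd C n \<in> hom (grp C n) (grp C (n - 1))) \<and>
     (\<forall>n. \<forall>x\<in>carrier (grp C n). bd C (n - 1) (bd C n x) = \<one>\<^bsub>grp C (n - 2)\<^esub>)"

definition bounded_from_below :: "'a chain_cx \<Rightarrow> bool" where
  "bounded_from_below C \<longleftrightarrow> (\<exists>N. \<forall>n<N. trivial_group (grp C n))"

definition chain_map :: "'a chain_cx \<Rightarrow> 'b chain_cx \<Rightarrow> (int \<Rightarrow> 'a \<Rightarrow> 'b) \<Rightarrow> bool" where
  "chain_map C D f \<longleftrightarrow>
     (\<forall>n. f n \<in> hom (grp C n) (grp D n)) \<and>
     (\<forall>n. \<forall>x\<in>carrier (grp C n). bd D n (f n x) = f (n - 1) (bd C n x))"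

text \<open>\<open>f - g = \<partial>h + h\<partial>\<close> for some map \<open>h\<close> of degree 1.\<close>

definition chain_homotopic ::
  "'a chain_cx \<Rightarrow> 'b chain_cx \<Rightarrow> (int \<Rightarrow> 'a \<Rightarrow> 'b) \<Rightarrow> (int \<Rightarrow> 'a \<Rightarrow> 'b) \<Rightarrow> bool" where
  "chain_homotopic C D f g \<longleftrightarrow>
     (\<exists>h. (\<forall>n. h n \<in> hom (grp C n) (grp D (n + 1))) \<and>
          (\<forall>n. \<forall>x\<in>carrier (grp C n).
             f n x \<otimes>\<^bsub>grp D n\<^esub> inv\<^bsub>grp D n\<^esub> g n x =
             bd D (n + 1) (h n x) \<otimes>\<^bsub>grp D n\<^esub> h (n - 1) (bd C n x)))"

definition int_chain_cx :: "int chain_cx" where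
  "int_chain_cx =
     \<lparr>grp = (\<lambda>n. if n = 0 then integer_group else singleton_group 0), bd = (\<lambda>n x. 0)\<rparr>"


section \<open>Tensor products of Abelian groups\<close>

text \<open>
  \<open>A \<otimes> B\<close> is the free Abelian group on \<open>carrier A \<times> carrier B\<close> modulo the subgroup
  generated by the bilinearity relations.
\<close>

definition tensor_rels :: "'a monoid \<Rightarrow> 'b monoid \<Rightarrow> (('a \<times> 'b) \<Rightarrow>\<^sub>0 int) set" where
  "tensor_rels A B =
     {frag_of (a \<otimes>\<^bsub>A\<^esub> a', b) - frag_of (a, b) - frag_of (a', b) | a a' b.
        a \<in> carrier A \<and> a' \<in> carrier A \<and> b \<in> carrier B} \<union>
     {frag_of (a, b \<otimes>\<^bsub>B\<^esub> b') - frag_of (a, b) - frag_of (a, b') | a b b'.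
        a \<in> carrier A \<and> b \<in> carrier B \<and> b' \<in> carrier B}"

definition tensor_null :: "'a monoid \<Rightarrow> 'b monoid \<Rightarrow> (('a \<times> 'b) \<Rightarrow>\<^sub>0 int) set" where
  "tensor_null A B = generate (free_Abelian_group (carrier A \<times> carrier B)) (tensor_rels A B)"

definition tensor_group ::
  "'a monoid \<Rightarrow> 'b monoid \<Rightarrow> (('a \<times> 'b) \<Rightarrow>\<^sub>0 int) set monoid" where
  "tensor_group A B = free_Abelian_group (carrier A \<times> carrier B) Mod tensor_null A B"

definition tensor_class ::
  "'a monoid \<Rightarrow> 'b monoid \<Rightarrow> (('a \<times> 'b) \<Rightarrow>\<^sub>0 int) \<Rightarrow> (('a \<times> 'b) \<Rightarrow>\<^sub>0 int) set" where
  "tensor_class A B x = tensor_null A B #>\<^bsub>free_Abelian_group (carrier A \<times> carrier B)\<^esub> x"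

text \<open>
  The homomorphism \<open>f \<otimes> g\<close> into \<open>A' \<otimes> B'\<close>, characterised by \<open>a \<otimes> b \<mapsto> f a \<otimes> g b\<close>.
  For homomorphisms \<open>f\<close> and \<open>g\<close>, all members of a coset \<open>X\<close> have the same image.
\<close>

definition tensor_hom ::
  "'c monoid \<Rightarrow> 'd monoid \<Rightarrow> ('a \<Rightarrow> 'c) \<Rightarrow> ('b \<Rightarrow> 'd) \<Rightarrow>
   (('a \<times> 'b) \<Rightarrow>\<^sub>0 int) set \<Rightarrow> (('c \<times> 'd) \<Rightarrow>\<^sub>0 int) set" where
  "tensor_hom A' B' f g X =
     the_elem ((\<lambda>x. tensor_class A' B' (frag_extend (\<lambda>(a, b). frag_of (f a, g b)) x)) ` X)"


section \<open>Tensor products of chain complexes\<close>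

text \<open>
  \<open>(C \<otimes> D)\<^sub>n\<close> is the direct sum over all \<open>p\<close> of \<open>C\<^sub>p \<otimes> D\<^sub>n\<^sub>-\<^sub>p\<close>, with
  \<open>\<partial>(x \<otimes> y) = \<partial>x \<otimes> y + (-1)\<^sup>p x \<otimes> \<partial>y\<close> for \<open>x\<close> of degree \<open>p\<close>. Thus the component of
  \<open>\<partial>z\<close> in \<open>C\<^sub>p \<otimes> D\<^sub>n\<^sub>-\<^sub>1\<^sub>-\<^sub>p\<close> receives a contribution from \<open>z (p + 1)\<close> and one from \<open>z p\<close>. The direct sum
  \<^const>\<open>sum_group\<close> consists of the families with only finitely many nonzero components.
\<close>

definition tensor_complex ::
  "'a chain_cx \<Rightarrow> 'b chain_cx \<Rightarrow> (int \<Rightarrow> (('a \<times> 'b) \<Rightarrow>\<^sub>0 int) set) chain_cx" where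
  "tensor_complex C D =
     \<lparr>grp = (\<lambda>n. sum_group UNIV (\<lambda>p. tensor_group (grp C p) (grp D (n - p)))),
      bd = (\<lambda>n z p.
        let A = grp C p; B = grp D (n - 1 - p); T = tensor_group A B;
            u = tensor_hom A B (bd C (p + 1)) (\<lambda>y. y) (z (p + 1));
            v = tensor_hom A B (\<lambda>x. x) (bd D (n - p)) (z p)
        in u \<otimes>\<^bsub>T\<^esub> (if even p then v else inv\<^bsub>T\<^esub> v))\<rparr>"

text \<open>\<open>f \<otimes> g\<close> for maps \<open>f\<close>, \<open>g\<close> of degree 0 into \<open>C'\<close> and \<open>D'\<close>; no signs occur.\<close>

definition tensor_chain_map ::
  "'c chain_cx \<Rightarrow> 'd chain_cx \<Rightarrow> (int \<Rightarrow> 'a \<Rightarrow> 'c) \<Rightarrow> (int \<Rightarrow> 'b \<Rightarrow> 'd) \<Rightarrow>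
   int \<Rightarrow> (int \<Rightarrow> (('a \<times> 'b) \<Rightarrow>\<^sub>0 int) set) \<Rightarrow> (int \<Rightarrow> (('c \<times> 'd) \<Rightarrow>\<^sub>0 int) set)" where
  "tensor_chain_map C' D' f g n z =
     (\<lambda>p. tensor_hom (grp C' p) (grp D' (n - p)) (f p) (g (n - p)) (z p))"

end

theory Submission
  imports Defs
begin

text \<open>
  Let \<open>H\<close> be a homotopy with \<open>\<partial>H + H\<partial> = \<phi> \<otimes> \<psi> - \<psi> \<otimes> \<phi>\<close>. Since \<open>\<epsilon>\<close> is a cycle of degree 0, \<open>s x = x \<otimes> \<epsilon>\<close>
  is a chain map \<open>C \<rightarrow> C \<otimes> C\<close>. Since \<open>\<delta>\<close> is a chain map to \<open>(\<int>, 0)\<close>, another chain map is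
  \<open>e = id \<otimes> \<delta> : C' \<otimes> C' \<rightarrow> C' \<otimes> \<int> = C'\<close>, which takes \<open>x \<otimes> y\<close> to \<open>\<delta>(y) x\<close> for \<open>y\<close> of degree 0
  and vanishes on \<open>x \<otimes> y\<close> for \<open>y\<close> of any other degree. Hence \<open>h = e H s\<close> is a homotopy between
  \<open>e (\<phi> \<otimes> \<psi>) s\<close> and \<open>e (\<psi> \<otimes> \<phi>) s\<close>. These maps are \<open>x \<mapsto> \<delta>(\<psi> \<epsilon>) \<phi> x = \<phi> x\<close> and
  \<open>x \<mapsto> \<delta>(\<phi> \<epsilon>) \<psi> x = \<psi> x\<close>.

  The three ingredients are the lemmas \<open>chain_map_tensor_right\<close> for \<open>s\<close>,
  \<open>tensor_contract_right\<close> for \<open>e\<close>, and \<open>chain_homotopic_compose\<close>. They rest on the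
  universal property of the tensor product (\<open>tensor_universal\<close>), on the fact that homomorphisms
  out of it are determined by their values on pure tensors (\<open>tensor_group_hom_ext\<close>), and on the
  formula \<open>(f \<otimes> g)(a \<otimes> b) = f a \<otimes> g b\<close> (\<open>tensor_hom_tensor\<close>).
\<close>

section \<open>Tensor products of Abelian groups\<close>

text \<open>The pure tensor \<open>a \<otimes> b\<close> in \<open>A \<otimes> B\<close>.\<close>

definition tensor :: "'a monoid \<Rightarrow> 'b monoid \<Rightarrow> 'a \<Rightarrow> 'b \<Rightarrow> (('a \<times> 'b) \<Rightarrow>\<^sub>0 int) set" where
  "tensor A B a b = tensor_class A B (frag_of (a, b))"

text \<open>
  Additivity in each variable separately; the values of \<open>f\<close> matter only on the carriers.
\<close>

definition bilinear_map :: "'a monoid \<Rightarrow> 'b monoid \<Rightarrow> 'c monoid \<Rightarrow> ('a \<Rightarrow> 'b \<Rightarrow> 'c) \<Rightarrow> bool" where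
  "bilinear_map A B G f \<longleftrightarrow>
     (\<forall>a\<in>carrier A. f a \<in> hom B G) \<and> (\<forall>b\<in>carrier B. (\<lambda>a. f a b) \<in> hom A G)"

lemma tensor_rels_subset:
  assumes "group A" "group B"
  shows "tensor_rels A B \<subseteq> carrier (free_Abelian_group (carrier A \<times> carrier B))"
proof -
  interpret A: group A by fact
  interpret B: group B by fact
  have closed: "x - y - z \<in> carrier (free_Abelian_group S)"
    if "x \<in> carrier (free_Abelian_group S)" "y \<in> carrier (free_Abelian_group S)"
      "z \<in> carrier (free_Abelian_group S)" for x y z and S :: "('a \<times> 'b) set"
    using that unfolding carrier_free_Abelian_group_iff by (meson Un_least keys_diff order_trans)
  show ?thesis
    unfolding tensor_rels_def
    by (intro Un_least subsetI; clarify; intro closed) (auto simp del: carrier_free_Abelian_group_iff)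
qed

lemma tensor_null_subgroup:
  assumes "group A" "group B"
  shows "subgroup (tensor_null A B) (free_Abelian_group (carrier A \<times> carrier B))"
  unfolding tensor_null_def
  by (rule group.generate_is_subgroup) (simp_all add: tensor_rels_subset assms)

lemma tensor_null_normal:
  assumes "group A" "group B"
  shows "tensor_null A B \<lhd> free_Abelian_group (carrier A \<times> carrier B)"
  using tensor_null_subgroup[OF assms] comm_group.normal_iff_subgroup[OF abelian_free_Abelian_group]
  by blast

lemma comm_group_tensor_group:
  assumes "group A" "group B"
  shows "comm_group (tensor_group A B)"
  unfolding tensor_group_def
  by (rule comm_group.abelian_FactGroup[OF abelian_free_Abelian_group tensor_null_subgroup[OF assms]])

lemma group_tensor_group: "group A \<Longrightarrow> group B \<Longrightarrow> group (tensor_group A B)"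
  using comm_group_tensor_group comm_group.axioms(2) by blast

lemma tensor_class_hom:
  assumes "group A" "group B"
  shows "tensor_class A B \<in> hom (free_Abelian_group (carrier A \<times> carrier B)) (tensor_group A B)"
proof -
  have "tensor_class A B = (\<lambda>x. tensor_null A B #>\<^bsub>free_Abelian_group (carrier A \<times> carrier B)\<^esub> x)"
    by (simp add: tensor_class_def fun_eq_iff)
  then show ?thesis
    unfolding tensor_group_def
    using normal.r_coset_hom_Mod[OF tensor_null_normal[OF assms]] by simp
qed

lemma tensor_group_carrierE:
  assumes "group A" "group B" and "X \<in> carrier (tensor_group A B)"
  obtains x where "x \<in> carrier (free_Abelian_group (carrier A \<times> carrier B))" "X = tensor_class A B x"
  using assms(3) unfolding tensor_group_def carrier_FactGroup tensor_class_def by blast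

lemma tensor_closed:
  assumes "group A" "group B" "a \<in> carrier A" "b \<in> carrier B"
  shows "tensor A B a b \<in> carrier (tensor_group A B)"
  unfolding tensor_def by (rule hom_in_carrier[OF tensor_class_hom]) (use assms in auto)

lemma hom_free_Abelian_group_diff:
  assumes "f \<in> hom (free_Abelian_group S) G" "group G"
    and "x \<in> carrier (free_Abelian_group S)" "y \<in> carrier (free_Abelian_group S)"
  shows "f (x - y) = f x \<otimes>\<^bsub>G\<^esub> inv\<^bsub>G\<^esub> f y"
proof -
  interpret group_hom "free_Abelian_group S" G f
    by (simp add: group_hom_def group_hom_axioms_def assms)
  have "x - y = x \<otimes>\<^bsub>free_Abelian_group S\<^esub> inv\<^bsub>free_Abelian_group S\<^esub> y"
    using assms(4) by simp
  then show ?thesis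
    using assms(3,4) by (simp only: hom_mult hom_inv G.inv_closed)
qed

lemma free_Abelian_group_hom_ext:
  assumes f: "f \<in> hom (free_Abelian_group S) G" and g: "g \<in> hom (free_Abelian_group S) G"
    and G: "group G" and eq: "\<And>s. s \<in> S \<Longrightarrow> f (frag_of s) = g (frag_of s)"
    and x: "x \<in> carrier (free_Abelian_group S)"
  shows "f x = g x"
proof -
  have "x \<in> carrier (free_Abelian_group S) \<and> f x = g x"
    using x[unfolded carrier_free_Abelian_group_iff]
  proof (induction rule: frag_induction)
    case zero
    show ?case
      using hom_one[OF f _ G] hom_one[OF g _ G] by simp
  next
    case (one s)
    then show ?case using eq by simp
  next
    case (diff a b)
    then have "a - b \<in> carrier (free_Abelian_group S)"
      using keys_diff[of a b] by auto
    then show ?case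
      using diff hom_free_Abelian_group_diff[OF f G] hom_free_Abelian_group_diff[OF g G] by metis
  qed
  then show ?thesis ..
qed

lemma tensor_group_hom_ext:
  assumes A: "group A" and B: "group B" and G: "group G"
    and f: "f \<in> hom (tensor_group A B) G" and g: "g \<in> hom (tensor_group A B) G"
    and eq: "\<And>a b. a \<in> carrier A \<Longrightarrow> b \<in> carrier B \<Longrightarrow> f (tensor A B a b) = g (tensor A B a b)"
    and X: "X \<in> carrier (tensor_group A B)"
  shows "f X = g X"
proof -
  obtain x where x: "x \<in> carrier (free_Abelian_group (carrier A \<times> carrier B))"
    and X_eq: "X = tensor_class A B x"
    using tensor_group_carrierE[OF A B X] .
  have "(f \<circ> tensor_class A B) x = (g \<circ> tensor_class A B) x"
    by (rule free_Abelian_group_hom_ext[OF hom_compose[OF tensor_class_hom[OF A B] f]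
          hom_compose[OF tensor_class_hom[OF A B] g] G _ x])
      (use eq in \<open>auto simp: tensor_def\<close>)
  then show ?thesis by (simp add: X_eq)
qed

lemma tensor_universal:
  assumes A: "group A" and B: "group B" and G: "comm_group G" and f: "bilinear_map A B G f"
  obtains L where "L \<in> hom (tensor_group A B) G"
    and "\<And>a b. a \<in> carrier A \<Longrightarrow> b \<in> carrier B \<Longrightarrow> L (tensor A B a b) = f a b"
proof -
  interpret A: group A by fact
  interpret B: group B by fact
  interpret G: comm_group G by fact
  let ?F = "free_Abelian_group (carrier A \<times> carrier B)"
  have fcl: "f a b \<in> carrier G" if "a \<in> carrier A" "b \<in> carrier B" for a b
    using f that unfolding bilinear_map_def by (blast intro: hom_in_carrier)
  have "(\<lambda>(a, b). f a b) ` (carrier A \<times> carrier B) \<subseteq> carrier G"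
    using fcl by auto
  then obtain h where h: "h \<in> hom ?F G"
    and hf: "\<And>p. p \<in> carrier A \<times> carrier B \<Longrightarrow> h (frag_of p) = (\<lambda>(a, b). f a b) p"
    using G.free_Abelian_group_universal by metis
  interpret h: group_hom ?F G h
    by (simp add: group_hom_def group_hom_axioms_def h G.is_group)
  have rel: "h (frag_of p - frag_of q - frag_of r) = \<one>\<^bsub>G\<^esub>"
    if "p \<in> carrier A \<times> carrier B" "q \<in> carrier A \<times> carrier B" "r \<in> carrier A \<times> carrier B"
      "h (frag_of p) = h (frag_of q) \<otimes>\<^bsub>G\<^esub> h (frag_of r)" for p q r
  proof -
    have F: "frag_of p \<in> carrier ?F" "frag_of q \<in> carrier ?F" "frag_of r \<in> carrier ?F"
      using that by auto
    have "frag_of p - frag_of q \<in> carrier ?F"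
      using F keys_diff[of "frag_of p" "frag_of q"] by auto
    then have "h (frag_of p - frag_of q - frag_of r) =
        h (frag_of p) \<otimes>\<^bsub>G\<^esub> inv\<^bsub>G\<^esub> h (frag_of q) \<otimes>\<^bsub>G\<^esub> inv\<^bsub>G\<^esub> h (frag_of r)"
      using F by (simp only: hom_free_Abelian_group_diff[OF h G.is_group])
    also have "\<dots> = \<one>\<^bsub>G\<^esub>"
    proof -
      have cl: "h (frag_of q) \<in> carrier G" "h (frag_of r) \<in> carrier G"
        using F h.hom_closed by blast+
      show ?thesis
        unfolding that(4) using cl by (simp only: G.m_assoc G.inv_mult[symmetric] G.m_closed G.inv_closed)
          (simp add: G.m_assoc[symmetric])
    qed
    finally show ?thesis .
  qed
  have "tensor_rels A B \<subseteq> kernel ?F G h"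
  proof
    fix x assume x: "x \<in> tensor_rels A B"
    have "h x = \<one>\<^bsub>G\<^esub>"
      using x f unfolding tensor_rels_def
      by (auto intro!: rel simp: hf bilinear_map_def hom_def)
    then show "x \<in> kernel ?F G h"
      using x tensor_rels_subset[OF A B] unfolding kernel_def by blast
  qed
  then have "tensor_null A B \<subseteq> kernel ?F G h"
    unfolding tensor_null_def by (rule h.generate_subgroup_incl[OF _ h.subgroup_kernel])
  then obtain L where L: "L \<in> hom (?F Mod tensor_null A B) G"
    and Lh: "\<And>x. x \<in> carrier ?F \<Longrightarrow> L (tensor_null A B #>\<^bsub>?F\<^esub> x) = h x"
    using h.FactGroup_universal_kernel[OF tensor_null_normal[OF A B]] by metis
  show thesis
  proof
    show "L \<in> hom (tensor_group A B) G"
      using L by (simp add: tensor_group_def)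
    show "L (tensor A B a b) = f a b" if "a \<in> carrier A" "b \<in> carrier B" for a b
      using that by (simp add: tensor_def tensor_class_def Lh hf)
  qed
qed

lemma bilinear_tensor:
  assumes A: "group A" and B: "group B"
  shows "bilinear_map A B (tensor_group A B) (tensor A B)"
proof -
  interpret A: group A by fact
  interpret B: group B by fact
  let ?F = "free_Abelian_group (carrier A \<times> carrier B)"
  let ?T = "tensor_group A B"
  interpret T: group ?T by (rule group_tensor_group[OF A B])
  note hom = tensor_class_hom[OF A B]
  have add: "tensor_class A B (frag_of p) =
      tensor_class A B (frag_of q) \<otimes>\<^bsub>?T\<^esub> tensor_class A B (frag_of r)"
    if pqr: "p \<in> carrier A \<times> carrier B" "q \<in> carrier A \<times> carrier B" "r \<in> carrier A \<times> carrier B"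
      and rel: "frag_of p - frag_of q - frag_of r \<in> tensor_rels A B" for p q r
  proof -
    \<comment> \<open>\<open>?n\<close> is a bilinearity relation, hence has trivial class, and the generator of \<open>p\<close> is
      the sum of \<open>?n\<close> and the generators of \<open>q\<close> and \<open>r\<close>\<close>
    let ?n = "frag_of p - frag_of q - frag_of r"
    have F: "frag_of q \<in> carrier ?F" "frag_of r \<in> carrier ?F"
      using pqr by auto
    have n: "?n \<in> tensor_null A B"
      unfolding tensor_null_def using rel by (rule generate.incl)
    have nF: "?n \<in> carrier ?F"
      using rel tensor_rels_subset[OF A B] by blast
    have "tensor_class A B ?n = tensor_null A B"
      unfolding tensor_class_def
      by (rule group.coset_join2[OF group_free_Abelian_group nF tensor_null_subgroup[OF A B] n])
    then have one: "tensor_class A B ?n = \<one>\<^bsub>?T\<^esub>"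
      by (simp add: tensor_group_def)
    have qr: "frag_of q \<otimes>\<^bsub>?F\<^esub> frag_of r \<in> carrier ?F"
      using F group.is_monoid[OF group_free_Abelian_group] by (intro monoid.m_closed)
    have "frag_of p = ?n \<otimes>\<^bsub>?F\<^esub> (frag_of q \<otimes>\<^bsub>?F\<^esub> frag_of r)" by simp
    also have "tensor_class A B \<dots> =
        tensor_class A B ?n \<otimes>\<^bsub>?T\<^esub> (tensor_class A B (frag_of q) \<otimes>\<^bsub>?T\<^esub> tensor_class A B (frag_of r))"
      by (simp only: hom_mult[OF hom nF qr] hom_mult[OF hom F])
    finally show ?thesis
      using one hom_in_carrier[OF hom F(1)] hom_in_carrier[OF hom F(2)] by simp
  qed
  show ?thesis
    unfolding bilinear_map_def
  proof (intro conjI ballI homI)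
    fix a b b' assume "a \<in> carrier A" "b \<in> carrier B" "b' \<in> carrier B"
    then show "tensor A B a (b \<otimes>\<^bsub>B\<^esub> b') = tensor A B a b \<otimes>\<^bsub>?T\<^esub> tensor A B a b'"
      unfolding tensor_def by (intro add) (auto simp: tensor_rels_def)
  next
    fix b a a' assume "a \<in> carrier A" "a' \<in> carrier A" "b \<in> carrier B"
    then show "tensor A B (a \<otimes>\<^bsub>A\<^esub> a') b = tensor A B a b \<otimes>\<^bsub>?T\<^esub> tensor A B a' b"
      unfolding tensor_def by (intro add) (auto simp: tensor_rels_def)
  qed (simp_all add: tensor_closed A B)
qed

lemma tensor_one_right:
  assumes "group A" "group B" "a \<in> carrier A"
  shows "tensor A B a \<one>\<^bsub>B\<^esub> = \<one>\<^bsub>tensor_group A B\<^esub>"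
  using bilinear_tensor[OF assms(1,2)] assms(3)
    hom_one[OF _ assms(2) group_tensor_group[OF assms(1,2)], of "tensor A B a"]
  by (simp add: bilinear_map_def)

text \<open>
  The universal property provides a homomorphism \<open>L\<close> with \<open>L (a \<otimes> b) = f a \<otimes> g b\<close>. The map
  \<^const>\<open>tensor_hom\<close>, defined through representatives of a coset, agrees with \<open>L\<close>; in
  particular it does not depend on the representative.
\<close>

lemma
  assumes A: "group A" and B: "group B" and A': "group A'" and B': "group B'"
    and f: "f \<in> hom A A'" and g: "g \<in> hom B B'"
  shows tensor_hom_hom: "tensor_hom A' B' f g \<in> hom (tensor_group A B) (tensor_group A' B')"
    and tensor_hom_tensor: "\<And>a b. a \<in> carrier A \<Longrightarrow> b \<in> carrier B \<Longrightarrow>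
      tensor_hom A' B' f g (tensor A B a b) = tensor A' B' (f a) (g b)"
proof -
  let ?F = "free_Abelian_group (carrier A \<times> carrier B)"
  let ?F' = "free_Abelian_group (carrier A' \<times> carrier B')"
  let ?T = "tensor_group A B"
  let ?T' = "tensor_group A' B'"
  let ?e = "frag_extend (\<lambda>(a, b). frag_of (f a, g b))"
  have "bilinear_map A B ?T' (\<lambda>a b. tensor A' B' (f a) (g b))"
    using bilinear_tensor[OF A' B'] hom_in_carrier[OF f] hom_in_carrier[OF g]
    by (auto simp: bilinear_map_def hom_def Pi_iff hom_mult[OF f] hom_mult[OF g])
  then obtain L where L: "L \<in> hom ?T ?T'"
    and Lt: "\<And>a b. a \<in> carrier A \<Longrightarrow> b \<in> carrier B \<Longrightarrow> L (tensor A B a b) = tensor A' B' (f a) (g b)"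
    using tensor_universal[OF A B comm_group_tensor_group[OF A' B']] by metis
  have e: "?e \<in> hom ?F ?F'"
  proof (rule homI)
    fix x assume "x \<in> carrier ?F"
    then show "?e x \<in> carrier ?F'"
      using keys_frag_extend[of "\<lambda>(a, b). frag_of (f a, g b)" x]
        hom_in_carrier[OF f] hom_in_carrier[OF g] by fastforce
  qed (simp add: frag_extend_add)
  have eL: "tensor_class A' B' (?e x) = L (tensor_class A B x)" if "x \<in> carrier ?F" for x
  proof -
    have "(tensor_class A' B' \<circ> ?e) x = (L \<circ> tensor_class A B) x"
      by (rule free_Abelian_group_hom_ext[OF hom_compose[OF e tensor_class_hom[OF A' B']]
            hom_compose[OF tensor_class_hom[OF A B] L] group_tensor_group[OF A' B'] _ that])
        (use Lt in \<open>auto simp: tensor_def\<close>)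
    then show ?thesis by simp
  qed
  have TL: "tensor_hom A' B' f g X = L X" if X: "X \<in> carrier ?T" for X
  proof -
    obtain x where x: "x \<in> carrier ?F" and Xx: "X = tensor_class A B x"
      using tensor_group_carrierE[OF A B X] .
    have class_eq: "y \<in> carrier ?F \<and> tensor_class A B y = X" if "y \<in> X" for y
      using that group.repr_independence[OF group_free_Abelian_group _ x tensor_null_subgroup[OF A B]]
        subgroup.elemrcos_carrier[OF tensor_null_subgroup[OF A B] group_free_Abelian_group x]
      unfolding Xx tensor_class_def by blast
    have "x \<in> X"
      unfolding Xx tensor_class_def
      by (rule group.rcos_self[OF group_free_Abelian_group x tensor_null_subgroup[OF A B]])
    moreover have "tensor_class A' B' (?e y) = L X" if "y \<in> X" for y
      using eL class_eq[OF that] by metis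
    ultimately have "(\<lambda>x. tensor_class A' B' (?e x)) ` X = {L X}"
      by blast
    then show ?thesis by (simp add: tensor_hom_def)
  qed
  show "tensor_hom A' B' f g \<in> hom ?T ?T'"
    by (rule homI) (simp_all add: TL hom_in_carrier[OF L] hom_mult[OF L]
        monoid.m_closed[OF group.is_monoid[OF group_tensor_group[OF A B]]])
  show "tensor_hom A' B' f g (tensor A B a b) = tensor A' B' (f a) (g b)"
    if "a \<in> carrier A" "b \<in> carrier B" for a b
    using that by (simp add: TL tensor_closed A B Lt)
qed

section \<open>Compositions of chain homotopies with chain maps\<close>

lemma chain_complex_group: "chain_complex C \<Longrightarrow> group (grp C n)"
  using comm_group.axioms(2) by (auto simp: chain_complex_def)

text \<open>
  Composition of homotopic maps \<open>f, g : K \<rightarrow> L\<close> with chain maps \<open>s : C \<rightarrow> K\<close> and \<open>e : L \<rightarrow> D\<close> on either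
  side. Of \<open>f\<close>, \<open>g\<close> and the boundary of \<open>L\<close>, only closure is needed: they need not be additive,
  and \<open>K\<close> and \<open>L\<close> need not be chain complexes.
\<close>

lemma chain_homotopic_compose:
  assumes hty: "chain_homotopic K L f g"
    and s: "chain_map C K s" and e: "chain_map L D e"
    and C: "chain_complex C"
    and L: "\<And>n. group (grp L n)" and D: "\<And>n. group (grp D n)"
    and bdL: "\<And>n. bd L n \<in> carrier (grp L n) \<rightarrow> carrier (grp L (n - 1))"
    and f: "\<And>n. f n \<in> carrier (grp K n) \<rightarrow> carrier (grp L n)"
    and g: "\<And>n. g n \<in> carrier (grp K n) \<rightarrow> carrier (grp L n)"
  shows "chain_homotopic C D (\<lambda>n. e n \<circ> f n \<circ> s n) (\<lambda>n. e n \<circ> g n \<circ> s n)"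
proof -
  obtain H where H: "\<And>n. H n \<in> hom (grp K n) (grp L (n + 1))"
    and H_eq: "\<And>n z. z \<in> carrier (grp K n) \<Longrightarrow>
      f n z \<otimes>\<^bsub>grp L n\<^esub> inv\<^bsub>grp L n\<^esub> g n z =
      bd L (n + 1) (H n z) \<otimes>\<^bsub>grp L n\<^esub> H (n - 1) (bd K n z)"
    using hty unfolding chain_homotopic_def by auto
  have s_hom: "s n \<in> hom (grp C n) (grp K n)" 
    and s_bd: "x \<in> carrier (grp C n) \<Longrightarrow> bd K n (s n x) = s (n - 1) (bd C n x)" for n x
    using s by (auto simp: chain_map_def)
  have e_hom: "e n \<in> hom (grp L n) (grp D n)" 
    and e_bd: "y \<in> carrier (grp L n) \<Longrightarrow> bd D n (e n y) = e (n - 1) (bd L n y)" for n y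
    using e by (auto simp: chain_map_def)
  let ?h = "\<lambda>n. e (n + 1) \<circ> H n \<circ> s n"
  have "e n (f n (s n x)) \<otimes>\<^bsub>grp D n\<^esub> inv\<^bsub>grp D n\<^esub> e n (g n (s n x)) =
      bd D (n + 1) (?h n x) \<otimes>\<^bsub>grp D n\<^esub> ?h (n - 1) (bd C n x)"
    if x: "x \<in> carrier (grp C n)" for n x
  proof -
    interpret e: group_hom "grp L n" "grp D n" "e n"
      by (simp add: group_hom_def group_hom_axioms_def e_hom L D)
    have z: "s n x \<in> carrier (grp K n)"
      using hom_in_carrier[OF s_hom x] .
    have "bd C n x \<in> carrier (grp C (n - 1))"
      using C x by (auto simp: chain_complex_def intro: hom_in_carrier)
    then have H1: "H (n - 1) (bd K n (s n x)) \<in> carrier (grp L n)"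
      using hom_in_carrier[OF H hom_in_carrier[OF s_hom], of "bd C n x" "n - 1"]
      by (simp add: s_bd[OF x])
    have H2: "H n (s n x) \<in> carrier (grp L (n + 1))"
      using hom_in_carrier[OF H z] .
    have H3: "bd L (n + 1) (H n (s n x)) \<in> carrier (grp L n)"
      using bdL[of "n + 1"] H2 by auto
    have "e n (f n (s n x)) \<otimes>\<^bsub>grp D n\<^esub> inv\<^bsub>grp D n\<^esub> e n (g n (s n x)) =
        e n (f n (s n x) \<otimes>\<^bsub>grp L n\<^esub> inv\<^bsub>grp L n\<^esub> g n (s n x))"
      using f g z by (simp add: Pi_iff)
    also have "\<dots> = e n (bd L (n + 1) (H n (s n x))) \<otimes>\<^bsub>grp D n\<^esub> e n (H (n - 1) (bd K n (s n x)))"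
      using H1 H3 by (simp add: H_eq[OF z])
    finally show ?thesis
      using e_bd[OF H2] by (simp add: s_bd[OF x])
  qed
  moreover have "?h n \<in> hom (grp C n) (grp D (n + 1))" for n
    by (rule hom_compose[OF s_hom hom_compose[OF H e_hom]])
  ultimately show ?thesis
    unfolding chain_homotopic_def by (intro exI[of _ ?h]) simp
qed

section \<open>Tensor products of chain complexes\<close>

lemma group_tensor_complex_summand:
  "chain_complex C \<Longrightarrow> chain_complex D \<Longrightarrow> group (tensor_group (grp C p) (grp D q))"
  by (simp add: group_tensor_group chain_complex_group)

lemma carrier_tensor_complex:
  assumes "chain_complex C" "chain_complex D"
  shows "carrier (grp (tensor_complex C D) n) =
    {z. (\<forall>p. z p \<in> carrier (tensor_group (grp C p) (grp D (n - p)))) \<and>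
        finite {p. z p \<noteq> \<one>\<^bsub>tensor_group (grp C p) (grp D (n - p))\<^esub>}}"
  by (auto simp: tensor_complex_def carrier_sum_group group_tensor_complex_summand assms PiE_def Pi_iff)

lemma group_tensor_complex:
  "chain_complex C \<Longrightarrow> chain_complex D \<Longrightarrow> group (grp (tensor_complex C D) n)"
  by (simp add: tensor_complex_def group_tensor_complex_summand)

lemma mult_tensor_complex:
  "x \<otimes>\<^bsub>grp (tensor_complex C D) n\<^esub> y =
    (\<lambda>p. x p \<otimes>\<^bsub>tensor_group (grp C p) (grp D (n - p))\<^esub> y p)"
  by (simp add: tensor_complex_def restrict_def)

lemma bd_tensor_complex_closed:
  assumes C: "chain_complex C" and D: "chain_complex D"
  shows "bd (tensor_complex C D) n \<in>
    carrier (grp (tensor_complex C D) n) \<rightarrow> carrier (grp (tensor_complex C D) (n - 1))"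
proof
  fix z assume "z \<in> carrier (grp (tensor_complex C D) n)"
  then have z: "\<And>p. z p \<in> carrier (tensor_group (grp C p) (grp D (n - p)))"
    and fin: "finite {p. z p \<noteq> \<one>\<^bsub>tensor_group (grp C p) (grp D (n - p))\<^esub>}"
    by (auto simp: carrier_tensor_complex C D)
  note gC = chain_complex_group[OF C] and gD = chain_complex_group[OF D]
  have bdC: "bd C (p + 1) \<in> hom (grp C (p + 1)) (grp C p)" for p
    using C unfolding chain_complex_def by (metis add_diff_cancel_right')
  have bdD: "bd D (n - p) \<in> hom (grp D (n - p)) (grp D (n - 1 - p))" for p
    using D unfolding chain_complex_def by (metis diff_right_commute)
  have id: "(\<lambda>x. x) \<in> hom G G" for G :: "'z monoid"
    by (simp add: hom_def)
  let ?T = "\<lambda>p. tensor_group (grp C p) (grp D (n - 1 - p))"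
  let ?u = "\<lambda>p. tensor_hom (grp C p) (grp D (n - 1 - p)) (bd C (p + 1)) (\<lambda>y. y)"
  let ?v = "\<lambda>p. tensor_hom (grp C p) (grp D (n - 1 - p)) (\<lambda>x. x) (bd D (n - p))"
  have u: "?u p \<in> hom (tensor_group (grp C (p + 1)) (grp D (n - (p + 1)))) (?T p)" for p
    using tensor_hom_hom[OF gC gD gC gD bdC[of p] id, of "n - 1 - p"]
    by (simp add: algebra_simps)
  have v: "?v p \<in> hom (tensor_group (grp C p) (grp D (n - p))) (?T p)" for p
    using tensor_hom_hom[OF gC gD gC gD id bdD[of p]] .
  note gT = group_tensor_complex_summand[OF C D]
  have uz: "?u p (z (p + 1)) \<in> carrier (?T p)" for p
    using hom_in_carrier[OF u z] .
  have vz: "?v p (z p) \<in> carrier (?T p)" for p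
    using hom_in_carrier[OF v z] .
  have bd: "bd (tensor_complex C D) n z p =
      ?u p (z (p + 1)) \<otimes>\<^bsub>?T p\<^esub> (if even p then ?v p (z p) else inv\<^bsub>?T p\<^esub> ?v p (z p))" for p
    by (simp add: tensor_complex_def Let_def)
  have bd_one: "bd (tensor_complex C D) n z p = \<one>\<^bsub>?T p\<^esub>"
    if "z (p + 1) = \<one>\<^bsub>tensor_group (grp C (p + 1)) (grp D (n - (p + 1)))\<^esub>"
      "z p = \<one>\<^bsub>tensor_group (grp C p) (grp D (n - p))\<^esub>" for p
    unfolding bd that using hom_one[OF u gT gT] hom_one[OF v gT gT]
    by (simp add: group.is_monoid[OF gT] monoid.inv_one)
  \<comment> \<open>the component of \<open>\<partial>z\<close> at \<open>p\<close> depends only on the components of \<open>z\<close> at \<open>p + 1\<close> and \<open>p\<close>\<close>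
  have "{p. bd (tensor_complex C D) n z p \<noteq> \<one>\<^bsub>?T p\<^esub>} \<subseteq>
      (\<lambda>p. p - 1) ` {p. z p \<noteq> \<one>\<^bsub>tensor_group (grp C p) (grp D (n - p))\<^esub>} \<union>
      {p. z p \<noteq> \<one>\<^bsub>tensor_group (grp C p) (grp D (n - p))\<^esub>}"
    (is "_ \<subseteq> (\<lambda>p. p - 1) ` ?S \<union> ?S")
  proof
    fix p assume "p \<in> {p. bd (tensor_complex C D) n z p \<noteq> \<one>\<^bsub>?T p\<^esub>}"
    then have "p + 1 \<in> ?S \<or> p \<in> ?S"
      using bd_one[of p] by blast
    then show "p \<in> (\<lambda>p. p - 1) ` ?S \<union> ?S"
      using image_eqI[of p "\<lambda>p. p - 1" "p + 1" ?S] by auto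
  qed
  with fin have "finite {p. bd (tensor_complex C D) n z p \<noteq> \<one>\<^bsub>?T p\<^esub>}"
    by (meson finite_UnI finite_imageI finite_subset)
  moreover have "bd (tensor_complex C D) n z p \<in> carrier (?T p)" for p
    unfolding bd using uz vz
    by (simp add: group.inv_closed[OF gT] monoid.m_closed[OF group.is_monoid[OF gT]])
  ultimately show "bd (tensor_complex C D) n z \<in> carrier (grp (tensor_complex C D) (n - 1))"
    by (simp add: carrier_tensor_complex C D)
qed

lemma tensor_chain_map_closed:
  assumes C: "chain_complex C" and D: "chain_complex D"
    and C': "chain_complex C'" and D': "chain_complex D'"
    and f: "chain_map C C' f" and g: "chain_map D D' g"
  shows "tensor_chain_map C' D' f g n \<in>
    carrier (grp (tensor_complex C D) n) \<rightarrow> carrier (grp (tensor_complex C' D') n)"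
proof
  fix z assume "z \<in> carrier (grp (tensor_complex C D) n)"
  then have z: "\<And>p. z p \<in> carrier (tensor_group (grp C p) (grp D (n - p)))"
    and fin: "finite {p. z p \<noteq> \<one>\<^bsub>tensor_group (grp C p) (grp D (n - p))\<^esub>}"
    by (auto simp: carrier_tensor_complex C D)
  have hom: "tensor_hom (grp C' p) (grp D' (n - p)) (f p) (g (n - p)) \<in>
      hom (tensor_group (grp C p) (grp D (n - p))) (tensor_group (grp C' p) (grp D' (n - p)))" for p
    using f g by (intro tensor_hom_hom chain_complex_group C D C' D') (auto simp: chain_map_def)
  show "tensor_chain_map C' D' f g n z \<in> carrier (grp (tensor_complex C' D') n)"
    using hom_in_carrier[OF hom z]
      hom_one[OF hom group_tensor_complex_summand[OF C D] group_tensor_complex_summand[OF C' D']]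
    by (auto simp: carrier_tensor_complex C' D' tensor_chain_map_def intro: finite_subset[OF _ fin])
qed

text \<open>
  The map \<open>x \<mapsto> x \<otimes> \<epsilon>\<close> for \<open>\<epsilon>\<close> of degree 0: for \<open>x\<close> of degree \<open>n\<close>, the family whose only nonzero
  component lies in \<open>C\<^sub>n \<otimes> D\<^sub>0\<close>.
\<close>

definition tensor_right :: "'a chain_cx \<Rightarrow> 'b chain_cx \<Rightarrow> 'b \<Rightarrow>
    int \<Rightarrow> 'a \<Rightarrow> (int \<Rightarrow> (('a \<times> 'b) \<Rightarrow>\<^sub>0 int) set)" where
  "tensor_right C D \<epsilon> n x =
     (\<lambda>p. if p = n then tensor (grp C n) (grp D 0) x \<epsilon>
          else \<one>\<^bsub>tensor_group (grp C p) (grp D (n - p))\<^esub>)"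

text \<open>No signs arise: \<open>\<partial>(x \<otimes> \<epsilon>) = \<partial>x \<otimes> \<epsilon> \<plusminus> x \<otimes> \<partial>\<epsilon> = \<partial>x \<otimes> \<epsilon>\<close>.\<close>

lemma chain_map_tensor_right:
  assumes C: "chain_complex C" and D: "chain_complex D"
    and \<epsilon>: "\<epsilon> \<in> carrier (grp D 0)" and cycle: "bd D 0 \<epsilon> = \<one>\<^bsub>grp D (-1)\<^esub>"
  shows "chain_map C (tensor_complex C D) (tensor_right C D \<epsilon>)"
  unfolding chain_map_def
proof (intro conjI allI ballI)
  note gC = chain_complex_group[OF C] and gD = chain_complex_group[OF D]
  note gT = group_tensor_complex_summand[OF C D]
  note mT = group.is_monoid[OF gT]
  show "tensor_right C D \<epsilon> n \<in> hom (grp C n) (grp (tensor_complex C D) n)" for n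
  proof (rule homI)
    fix x assume x: "x \<in> carrier (grp C n)"
    have "finite {p. tensor_right C D \<epsilon> n x p \<noteq> \<one>\<^bsub>tensor_group (grp C p) (grp D (n - p))\<^esub>}"
      by (rule finite_subset[of _ "{n}"]) (auto simp: tensor_right_def)
    then show "tensor_right C D \<epsilon> n x \<in> carrier (grp (tensor_complex C D) n)"
      using tensor_closed[OF gC gD x \<epsilon>] 
      by (auto simp: carrier_tensor_complex C D tensor_right_def monoid.one_closed[OF mT])
  next
    fix x y assume "x \<in> carrier (grp C n)" "y \<in> carrier (grp C n)"
    then show "tensor_right C D \<epsilon> n (x \<otimes>\<^bsub>grp C n\<^esub> y) =
        tensor_right C D \<epsilon> n x \<otimes>\<^bsub>grp (tensor_complex C D) n\<^esub> tensor_right C D \<epsilon> n y"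
      using bilinear_tensor[OF gC[of n] gD[of 0]] \<epsilon>
      by (auto simp: mult_tensor_complex tensor_right_def fun_eq_iff bilinear_map_def hom_def
          monoid.l_one[OF mT] monoid.one_closed[OF mT])
  qed
  fix n x assume x: "x \<in> carrier (grp C n)"
  have bdC: "bd C k \<in> hom (grp C k) (grp C (k - 1))" for k
    using C unfolding chain_complex_def by blast
  have bdD: "bd D k \<in> hom (grp D k) (grp D (k - 1))" for k
    using D unfolding chain_complex_def by blast
  have id: "(\<lambda>x. x) \<in> hom G G" for G :: "'z monoid"
    by (simp add: hom_def)
  have bdx: "bd C n x \<in> carrier (grp C (n - 1))"
    using hom_in_carrier[OF bdC x] .
  show "bd (tensor_complex C D) n (tensor_right C D \<epsilon> n x) =
      tensor_right C D \<epsilon> (n - 1) (bd C n x)"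
  proof
    fix p
    let ?T = "tensor_group (grp C p) (grp D (n - 1 - p))"
    let ?u = "tensor_hom (grp C p) (grp D (n - 1 - p)) (bd C (p + 1)) (\<lambda>y. y)"
    let ?v = "tensor_hom (grp C p) (grp D (n - 1 - p)) (\<lambda>x. x) (bd D (n - p))"
    let ?z = "tensor_right C D \<epsilon> n x"
    have u: "?u (?z (p + 1)) = tensor_right C D \<epsilon> (n - 1) (bd C n x) p"
    proof (cases "p = n - 1")
      case True
      then show ?thesis
        using tensor_hom_tensor[OF gC gD gC gD bdC id x \<epsilon>] by (simp add: tensor_right_def)
    next
      case False
      have hom: "?u \<in> hom (tensor_group (grp C (p + 1)) (grp D (n - (p + 1)))) ?T"
        using tensor_hom_hom[OF gC gD gC gD bdC[of "p + 1"] id, of "n - 1 - p"]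
        by (simp add: algebra_simps)
      have "?z (p + 1) = \<one>\<^bsub>tensor_group (grp C (p + 1)) (grp D (n - (p + 1)))\<^esub>"
        using False by (auto simp: tensor_right_def)
      then show ?thesis
        using False hom_one[OF hom gT gT] by (simp add: tensor_right_def)
    qed
    have v: "?v (?z p) = \<one>\<^bsub>?T\<^esub>"
    proof (cases "p = n")
      case True
      then show ?thesis
        using tensor_hom_tensor[OF gC gD gC gD id bdD x \<epsilon>] tensor_one_right[OF gC gD x]
        by (simp add: tensor_right_def cycle)
    next
      case False
      have hom: "?v \<in> hom (tensor_group (grp C p) (grp D (n - p))) ?T"
        using tensor_hom_hom[OF gC gD gC gD id bdD[of "n - p"], of p] by (simp add: algebra_simps)
      show ?thesis
        using False hom_one[OF hom gT gT] by (simp add: tensor_right_def)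
    qed
    have "tensor_right C D \<epsilon> (n - 1) (bd C n x) p \<in> carrier ?T"
      using tensor_closed[OF gC gD bdx \<epsilon>] by (simp add: tensor_right_def monoid.one_closed[OF mT])
    then show "bd (tensor_complex C D) n ?z p = tensor_right C D \<epsilon> (n - 1) (bd C n x) p"
      using u v
      by (simp add: tensor_complex_def Let_def monoid.r_one[OF mT] monoid.inv_one[OF mT])
  qed
qed

text \<open>
  The chain map \<open>id \<otimes> \<delta> : C \<otimes> D \<rightarrow> C\<close>. In degree \<open>n\<close> it is the projection to \<open>C\<^sub>n \<otimes> D\<^sub>0\<close> followed by the
  homomorphism \<open>L\<^sub>n\<close> with \<open>L\<^sub>n (x \<otimes> y) = \<delta>(y) x\<close>, an integer multiple that reads as a power in
  multiplicative notation. It commutes with the boundary because \<open>L\<^sub>n\<^sub>-\<^sub>1 (\<partial>x \<otimes> y) = \<partial>(L\<^sub>n (x \<otimes> y))\<close>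
  for \<open>y\<close> in \<open>D\<^sub>0\<close>, and because \<open>\<delta>\<close> kills the boundaries \<open>\<partial>y\<close> of the elements \<open>y\<close> of \<open>D\<^sub>1\<close>.
\<close>

lemma tensor_contract_right:
  assumes C: "chain_complex C" and D: "chain_complex D" and \<delta>: "chain_map D int_chain_cx \<delta>"
  obtains e where "chain_map (tensor_complex C D) C e"
    and "\<And>n x y z. x \<in> carrier (grp C n) \<Longrightarrow> y \<in> carrier (grp D 0) \<Longrightarrow>
      z n = tensor (grp C n) (grp D 0) x y \<Longrightarrow> e n z = x [^]\<^bsub>grp C n\<^esub> \<delta> 0 y"
proof -
  note gC = chain_complex_group[OF C] and gD = chain_complex_group[OF D]
  note gT = group_tensor_complex_summand[OF C D]
  have cC: "comm_group (grp C n)" for n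
    using C by (simp add: chain_complex_def)
  have bdC: "bd C k \<in> hom (grp C k) (grp C (k - 1))" for k
    using C unfolding chain_complex_def by blast
  have bdD: "bd D k \<in> hom (grp D k) (grp D (k - 1))" for k
    using D unfolding chain_complex_def by blast
  have id: "(\<lambda>x. x) \<in> hom G G" for G :: "'z monoid"
    by (simp add: hom_def)
  have "\<delta> 0 \<in> hom (grp D 0) (grp int_chain_cx 0)"
    using \<delta> by (simp add: chain_map_def)
  then have \<delta>_add: "\<delta> 0 (y \<otimes>\<^bsub>grp D 0\<^esub> y') = \<delta> 0 y + \<delta> 0 y'"
    if "y \<in> carrier (grp D 0)" "y' \<in> carrier (grp D 0)" for y y'
    using that by (simp add: int_chain_cx_def hom_def)
  have \<delta>_bd: "\<delta> 0 (bd D 1 y) = 0" if "y \<in> carrier (grp D 1)" for y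
  proof -
    have "bd int_chain_cx 1 (\<delta> 1 y) = \<delta> (1 - 1) (bd D 1 y)"
      using \<delta> that unfolding chain_map_def by blast
    then show ?thesis by (simp add: int_chain_cx_def)
  qed
  have bil: "bilinear_map (grp C n) (grp D 0) (grp C n) (\<lambda>x y. x [^]\<^bsub>grp C n\<^esub> \<delta> 0 y)" for n
    by (auto simp: bilinear_map_def hom_def \<delta>_add group.int_pow_mult[OF gC]
        group.int_pow_closed[OF gC] comm_group.int_pow_distrib[OF cC])
  have "\<exists>L. L \<in> hom (tensor_group (grp C n) (grp D 0)) (grp C n) \<and>
     (\<forall>x\<in>carrier (grp C n). \<forall>y\<in>carrier (grp D 0).
        L (tensor (grp C n) (grp D 0) x y) = x [^]\<^bsub>grp C n\<^esub> \<delta> 0 y)" for n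
    by (rule tensor_universal[OF gC gD cC bil[of n]]) blast
  then obtain L where L: "\<And>n. L n \<in> hom (tensor_group (grp C n) (grp D 0)) (grp C n)"
    and Lt: "\<And>n x y. x \<in> carrier (grp C n) \<Longrightarrow> y \<in> carrier (grp D 0) \<Longrightarrow>
       L n (tensor (grp C n) (grp D 0) x y) = x [^]\<^bsub>grp C n\<^esub> \<delta> 0 y"
    by metis
  have Lbd: "L (n - 1) (tensor_hom (grp C (n - 1)) (grp D 0) (bd C n) (\<lambda>y. y) w) = bd C n (L n w)"
    if w: "w \<in> carrier (tensor_group (grp C n) (grp D 0))" for n w
  proof -
    interpret b: group_hom "grp C n" "grp C (n - 1)" "bd C n"
      by (simp add: group_hom_def group_hom_axioms_def gC bdC)
    have "(L (n - 1) \<circ> tensor_hom (grp C (n - 1)) (grp D 0) (bd C n) (\<lambda>y. y)) w = (bd C n \<circ> L n) w"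
    proof (rule tensor_group_hom_ext[OF gC gD gC _ _ _ w])
      fix x y assume xy: "x \<in> carrier (grp C n)" "y \<in> carrier (grp D 0)"
      then show "(L (n - 1) \<circ> tensor_hom (grp C (n - 1)) (grp D 0) (bd C n) (\<lambda>y. y))
            (tensor (grp C n) (grp D 0) x y) = (bd C n \<circ> L n) (tensor (grp C n) (grp D 0) x y)"
        by (simp add: tensor_hom_tensor[OF gC gD gC gD bdC id xy] Lt b.hom_int_pow hom_in_carrier[OF bdC])
    qed (rule hom_compose[OF tensor_hom_hom[OF gC gD gC gD bdC id] L] hom_compose[OF L bdC])+
    then show ?thesis by simp
  qed
  have Lnull: "L n (tensor_hom (grp C n) (grp D 0) (\<lambda>x. x) (bd D 1) w) = \<one>\<^bsub>grp C n\<^esub>"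
    if w: "w \<in> carrier (tensor_group (grp C n) (grp D 1))" for n w
  proof -
    have bd1: "bd D 1 \<in> hom (grp D 1) (grp D 0)"
      using bdD[of 1] by simp
    have "(L n \<circ> tensor_hom (grp C n) (grp D 0) (\<lambda>x. x) (bd D 1)) w = (\<lambda>_. \<one>\<^bsub>grp C n\<^esub>) w"
    proof (rule tensor_group_hom_ext[OF gC gD gC _ _ _ w])
      fix x y assume xy: "x \<in> carrier (grp C n)" "y \<in> carrier (grp D 1)"
      then show "(L n \<circ> tensor_hom (grp C n) (grp D 0) (\<lambda>x. x) (bd D 1))
          (tensor (grp C n) (grp D 1) x y) = \<one>\<^bsub>grp C n\<^esub>"
        by (simp add: tensor_hom_tensor[OF gC gD gC gD id bd1 xy] Lt \<delta>_bd hom_in_carrier[OF bd1])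
    next
      show "(\<lambda>_. \<one>\<^bsub>grp C n\<^esub>) \<in> hom (tensor_group (grp C n) (grp D 1)) (grp C n)"
        by (simp add: trivial_hom gC)
    qed (rule hom_compose[OF tensor_hom_hom[OF gC gD gC gD id bd1] L])
    then show ?thesis by simp
  qed
  show thesis
  proof
    show "chain_map (tensor_complex C D) C (\<lambda>n z. L n (z n))"
      unfolding chain_map_def
    proof (intro conjI allI ballI)
      have z_n: "z n \<in> carrier (tensor_group (grp C n) (grp D 0))"
        if "z \<in> carrier (grp (tensor_complex C D) n)" for z n
      proof -
        have "z n \<in> carrier (tensor_group (grp C n) (grp D (n - n)))"
          using that unfolding carrier_tensor_complex[OF C D] by blast
        then show ?thesis by simp
      qed
      show "(\<lambda>z. L n (z n)) \<in> hom (grp (tensor_complex C D) n) (grp C n)" for n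
        by (rule homI) (simp_all add: mult_tensor_complex z_n hom_in_carrier[OF L] hom_mult[OF L])
      fix n z assume z: "z \<in> carrier (grp (tensor_complex C D) n)"
      let ?u = "tensor_hom (grp C (n - 1)) (grp D 0) (bd C n) (\<lambda>y. y) (z n)"
      let ?v = "tensor_hom (grp C (n - 1)) (grp D 0) (\<lambda>x. x) (bd D 1) (z (n - 1))"
      let ?T = "tensor_group (grp C (n - 1)) (grp D 0)"
      interpret L: group_hom ?T "grp C (n - 1)" "L (n - 1)"
        by (simp add: group_hom_def group_hom_axioms_def gC gT L)
      have z1: "z (n - 1) \<in> carrier (tensor_group (grp C (n - 1)) (grp D 1))"
      proof -
        have "z (n - 1) \<in> carrier (tensor_group (grp C (n - 1)) (grp D (n - (n - 1))))"
          using z unfolding carrier_tensor_complex[OF C D] by blast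
        then show ?thesis by simp
      qed
      have bd1: "bd D 1 \<in> hom (grp D 1) (grp D 0)"
        using bdD[of 1] by simp
      have u: "?u \<in> carrier ?T"
        using hom_in_carrier[OF tensor_hom_hom[OF gC gD gC gD bdC id] z_n[OF z]] .
      have v: "?v \<in> carrier ?T"
        using hom_in_carrier[OF tensor_hom_hom[OF gC gD gC gD id bd1] z1] .
      have "bd (tensor_complex C D) n z (n - 1) =
          ?u \<otimes>\<^bsub>?T\<^esub> (if even (n - 1) then ?v else inv\<^bsub>?T\<^esub> ?v)"
        by (simp add: tensor_complex_def Let_def)
      then have "L (n - 1) (bd (tensor_complex C D) n z (n - 1)) = L (n - 1) ?u"
        using u v by (simp add: Lnull[OF z1] del: even_diff)
      then show "bd C n (L n (z n)) = L (n - 1) (bd (tensor_complex C D) n z (n - 1))"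
        using Lbd[OF z_n[OF z]] by simp
    qed
  qed (simp add: Lt)
qed

theorem lemma4p6:
  fixes C :: "'a chain_cx" and C' :: "'b chain_cx"
    and \<phi> \<psi> :: "int \<Rightarrow> 'a \<Rightarrow> 'b" and \<epsilon> :: 'a and \<delta> :: "int \<Rightarrow> 'b \<Rightarrow> int"
  assumes "chain_complex C" and "bounded_from_below C"
    and "chain_complex C'" and "bounded_from_below C'"
    and "chain_map C C' \<phi>" and "chain_map C C' \<psi>"
    and "\<epsilon> \<in> carrier (grp C 0)" and "bd C 0 \<epsilon> = \<one>\<^bsub>grp C (-1)\<^esub>"
    and "chain_map C' int_chain_cx \<delta>"
    and "\<delta> 0 (\<phi> 0 \<epsilon>) = 1" and "\<delta> 0 (\<psi> 0 \<epsilon>) = 1"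
    and "chain_homotopic (tensor_complex C C) (tensor_complex C' C')
           (tensor_chain_map C' C' \<phi> \<psi>) (tensor_chain_map C' C' \<psi> \<phi>)"
  shows "chain_homotopic C C' \<phi> \<psi>"
proof -
  note C = assms(1) and C' = assms(3) and \<phi> = assms(5) and \<psi> = assms(6) and \<epsilon> = assms(7)
  note gC = chain_complex_group[OF C] and gC' = chain_complex_group[OF C']
  let ?s = "tensor_right C C \<epsilon>"
  obtain e where e: "chain_map (tensor_complex C' C') C' e"
    and e_tensor: "\<And>n x y z. x \<in> carrier (grp C' n) \<Longrightarrow> y \<in> carrier (grp C' 0) \<Longrightarrow>
      z n = tensor (grp C' n) (grp C' 0) x y \<Longrightarrow> e n z = x [^]\<^bsub>grp C' n\<^esub> \<delta> 0 y"
    using tensor_contract_right[OF C' C' assms(9)] by metis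
  have hty: "chain_homotopic C C'
      (\<lambda>n. e n \<circ> tensor_chain_map C' C' \<phi> \<psi> n \<circ> ?s n) (\<lambda>n. e n \<circ> tensor_chain_map C' C' \<psi> \<phi> n \<circ> ?s n)"
    by (rule chain_homotopic_compose[OF assms(12) chain_map_tensor_right[OF C C \<epsilon> assms(8)] e C
          group_tensor_complex[OF C' C'] gC' bd_tensor_complex_closed[OF C' C']
          tensor_chain_map_closed[OF C C C' C' \<phi> \<psi>] tensor_chain_map_closed[OF C C C' C' \<psi> \<phi>]])
  have eval: "e n (tensor_chain_map C' C' f g n (?s n x)) = f n x"
    if f: "chain_map C C' f" and g: "chain_map C C' g" and one: "\<delta> 0 (g 0 \<epsilon>) = 1"
      and x: "x \<in> carrier (grp C n)" for f g n x
  proof -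
    have fh: "f n \<in> hom (grp C n) (grp C' n)" and gh: "g 0 \<in> hom (grp C 0) (grp C' 0)"
      using f g by (simp_all add: chain_map_def)
    note cl = hom_in_carrier[OF fh x] hom_in_carrier[OF gh \<epsilon>]
    have "tensor_chain_map C' C' f g n (?s n x) n = tensor (grp C' n) (grp C' 0) (f n x) (g 0 \<epsilon>)"
      using tensor_hom_tensor[OF gC gC gC' gC' fh gh x \<epsilon>]
      by (simp add: tensor_chain_map_def tensor_right_def)
    then have "e n (tensor_chain_map C' C' f g n (?s n x)) = f n x [^]\<^bsub>grp C' n\<^esub> (1::int)"
      using e_tensor[OF cl] one by simp
    then show ?thesis
      using cl by (simp add: group.int_pow_1[OF gC'])
  qed
  show ?thesis
    using hty eval[OF \<phi> \<psi> assms(11)] eval[OF \<psi> \<phi> assms(10)]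
    unfolding chain_homotopic_def by simp
qed

end
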